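(* Let $U_0\in (V_{N_g})^N\cap\mathcal M^N$, let $\Delta t_n>0$ for $n\in\mathbb N$, and let $\{U_n\}_{n\in\mathbb N}\subset (V_{N_g})^N$ be obtained from the midpoint scheme, i.e. for every $n$ $$\frac{U_{n+1}-U_n}{\Delta t_n}=-\nabla_G E\Big(\frac{U_{n+1}+U_n}2\Big).$$ Then $U_n\in (V_{N_g})^N\cap\mathcal M^N$ for all $n\in\mathbb N$.
   Context: Setting. $N\ge 1$; $V_{N_g}\subset H^1(\mathbb R^3)$ is a finite-dimensional space (dimension $N_g$) of real-valued functions. For $N$-tuples $\Psi,\Phi$ of functions, $\langle\Psi^\top\Phi\rangle=((\psi_i,\varphi_j)_{L^2(\mathbb R^3)})_{i,j=1}^N$, $(\Psi,\Phi)=\mathrm{tr}\langle\Psi^\top\Phi\rangle$. For $P\in\mathbb R^{N\times N}$, $UP$ is the $N$-tuple with $i$-th entry $\sum_j p_{ji}u_j$. $\mathcal M^N=\{U\in (H^1(\mathbb R^3))^N:\langle U^\top U\rangle=I_N\}$. Energy. $E$ is the Kohn-Sham energy $$E(U)=\sum_{i=1}^N\int_{\mathbb R^3}|\nabla u_i|^2\,dr+\int_{\mathbb R^3}V_{ext}\rho_U\,dr+\frac12\iint\frac{\rho_U(r)\rho_U(r')}{|r-r'|}\,dr\,dr'+\int_{\mathbb R^3}\varepsilon_{xc}(\rho_U)\rho_U\,dr,\qquad \rho_U=2\sum_{i=1}^N|u_i|^2,$$ where $V_{ext}$ is the external potential (for full potential calculations $V_{ext}(r)=-\sum_{I=1}^M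 Z_I/|r-R_I|$). The exchange-correlation term is assumed differentiable, with potential $v_{xc}(\rho)=\delta(\rho\,\varepsilon_{xc}(\rho))/\delta\rho$; thus $E$ is differentiable on $(V_{N_g})^N$, and $\nabla E(U)\in (V_{N_g})^N$ denotes its gradient with respect to $(\cdot,\cdot)$, i.e. for every $v\in V_{N_g}$ $$((\nabla E(U))_i,v)_{L^2}=4\Big(\tfrac12(\nabla u_i,\nabla v)_{L^2}+(V_{ext}u_i,v)_{L^2}+\Big(\int\frac{\rho_U(r')}{|\cdot-r'|}dr'\,u_i,v\Big)_{L^2}+(v_{xc}(\rho_U)u_i,v)_{L^2}\Big).$$ In particular $\langle U^\top\nabla E(U)\rangle$ is symmetric. Extended Grassmann gradient. For $U\in (V_{N_g})^N$, $\nabla_G E(U)=\nabla E(U)\langle U^\top U\rangle-U\langle U^\top\nabla E(U)\rangle$. *)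

theory Defs
  imports "HOL-Analysis.Analysis"
begin

section \<open>The Sobolev space $H^1(\mathbf{R}^3)$\<close>

text \<open>
  Elements of $L^2$ and $H^1$ are represented by Borel functions; representatives that agree
  almost everywhere are the same element, so equations between them are stated with AE.
\<close>

type_synonym fn = "real^3 \<Rightarrow> real"

definition square_integrable :: "fn \<Rightarrow> bool" where
  "square_integrable u \<longleftrightarrow> u \<in> borel_measurable lborel \<and> integrable lborel (\<lambda>r. (u r)\<^sup>2)"

definition L2_inner :: "fn \<Rightarrow> fn \<Rightarrow> real" where
  "L2_inner u v = (LINT r|lborel. u r * v r)"

definition partial_deriv :: "3 \<Rightarrow> fn \<Rightarrow> fn" where
  "partial_deriv k f r = frechet_derivative f (at r) (axis k 1)"

primrec C_k :: "nat \<Rightarrow> fn \<Rightarrow> bool" where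
  "C_k 0 f \<longleftrightarrow> continuous_on UNIV f"
| "C_k (Suc m) f \<longleftrightarrow> (\<forall>r. f differentiable (at r)) \<and> (\<forall>k. C_k m (partial_deriv k f))"

definition test_function :: "fn \<Rightarrow> bool" where
  "test_function f \<longleftrightarrow> (\<forall>m. C_k m f) \<and> compact (closure {r. f r \<noteq> 0})"

definition has_weak_gradient :: "fn \<Rightarrow> (real^3 \<Rightarrow> real^3) \<Rightarrow> bool" where
  "has_weak_gradient u g \<longleftrightarrow>
     (\<forall>k. square_integrable (\<lambda>r. g r $ k)) \<and>
     (\<forall>f k. test_function f \<longrightarrow> L2_inner u (partial_deriv k f) = - L2_inner (\<lambda>r. g r $ k) f)"

definition H1 :: "fn set" where
  "H1 = {u. square_integrable u \<and> (\<exists>g. has_weak_gradient u g)}"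

text \<open>The weak gradient of an element of $H^1$ is unique up to almost everywhere equality.\<close>

definition weak_grad :: "fn \<Rightarrow> real^3 \<Rightarrow> real^3" where
  "weak_grad u = (SOME g. has_weak_gradient u g)"

definition grad_inner :: "fn \<Rightarrow> fn \<Rightarrow> real" where
  "grad_inner u v = (LINT r|lborel. weak_grad u r \<bullet> weak_grad v r)"

text \<open>
  The set \<open>V\<close> contains every representative of each of its elements; linear independence
  of the basis is linear independence in $H^1$, i.e. modulo almost everywhere equality.
\<close>

definition H1_subspace_of_dim :: "fn set \<Rightarrow> nat \<Rightarrow> bool" where
  "H1_subspace_of_dim V d \<longleftrightarrow>
     (\<exists>b :: nat \<Rightarrow> fn.
        (\<forall>k<d. b k \<in> H1) \<and>
        (\<forall>c :: nat \<Rightarrow> real. (AE r in lborel. (\<Sum>k<d. c k * b k r) = 0) \<longrightarrow> (\<forall>k<d. c k = 0)) \<and>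
        V = {v \<in> H1. \<exists>c :: nat \<Rightarrow> real. AE r in lborel. v r = (\<Sum>k<d. c k * b k r)})"


section \<open>Tuples of functions\<close>

text \<open>An $N$-tuple is indexed by a finite type \<open>'n\<close> with \<open>CARD('n)\<close> equal to $N$.\<close>

type_synonym 'n tup = "'n \<Rightarrow> fn"

definition tuples :: "fn set \<Rightarrow> ('n::finite) tup set" where
  "tuples V = {U. \<forall>i. U i \<in> V}"

definition gram :: "('n::finite) tup \<Rightarrow> 'n tup \<Rightarrow> real^'n^'n" where
  "gram \<Psi> \<Phi> = (\<chi> i j. L2_inner (\<Psi> i) (\<Phi> j))"

definition tuple_inner :: "('n::finite) tup \<Rightarrow> 'n tup \<Rightarrow> real" where
  "tuple_inner \<Psi> \<Phi> = trace (gram \<Psi> \<Phi>)"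

definition tuple_norm :: "('n::finite) tup \<Rightarrow> real" where
  "tuple_norm \<Phi> = sqrt (tuple_inner \<Phi> \<Phi>)"

definition tuple_add :: "('n::finite) tup \<Rightarrow> 'n tup \<Rightarrow> 'n tup" where
  "tuple_add U \<Phi> = (\<lambda>i r. U i r + \<Phi> i r)"

definition tuple_mult :: "('n::finite) tup \<Rightarrow> real^'n^'n \<Rightarrow> 'n tup" where
  "tuple_mult U P = (\<lambda>i r. \<Sum>j\<in>UNIV. P $ j $ i * U j r)"

definition stiefel :: "('n::finite) tup set" where
  "stiefel = {U. (\<forall>i. U i \<in> H1) \<and> gram U U = mat 1}"


section \<open>Kohn-Sham energy and its gradient\<close>

definition density :: "('n::finite) tup \<Rightarrow> fn" where
  "density U r = 2 * (\<Sum>i\<in>UNIV. \<bar>U i r\<bar>\<^sup>2)"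

text \<open>
  \<open>eps \<rho>\<close> is the function $\varepsilon_{xc}(\rho)$; it may depend on \<open>\<rho>\<close> pointwise, as in the
  local density approximation \<open>eps \<rho> r = e (\<rho> r)\<close>, or as a functional. The same convention is
  used for the potential \<open>vxc\<close>.
\<close>

definition xc_energy :: "(fn \<Rightarrow> fn) \<Rightarrow> fn \<Rightarrow> real" where
  "xc_energy eps \<rho> = (LINT r|lborel. eps \<rho> r * \<rho> r)"

definition ks_energy :: "fn \<Rightarrow> (fn \<Rightarrow> fn) \<Rightarrow> ('n::finite) tup \<Rightarrow> real" where
  "ks_energy Vext eps U =
     (\<Sum>i\<in>UNIV. LINT r|lborel. (norm (weak_grad (U i) r))\<^sup>2)
     + (LINT r|lborel. Vext r * density U r)
     + 1/2 * (LINT r|lborel. LINT r'|lborel. density U r * density U r' / norm (r - r'))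
     + xc_energy eps (density U)"

definition hartree_potential :: "fn \<Rightarrow> fn" where
  "hartree_potential \<rho> r = (LINT r'|lborel. \<rho> r' / norm (r - r'))"

text \<open>
  Frechet differentiability on the tuples over \<open>V\<close>, with differential \<open>D\<close> at \<open>U\<close>. The norm used
  is the $L^2$ norm; all norms are equivalent on a finite-dimensional space.
  It is only used below for \<open>D\<close> that are linear on these tuples.
\<close>

definition has_differential_on ::
    "fn set \<Rightarrow> (('n::finite) tup \<Rightarrow> real) \<Rightarrow> ('n tup \<Rightarrow> real) \<Rightarrow> 'n tup \<Rightarrow> bool" where
  "has_differential_on V F D U \<longleftrightarrow>
     (\<forall>\<epsilon>>0. \<exists>\<delta>>0. \<forall>\<Phi>\<in>tuples V. tuple_norm \<Phi> < \<delta> \<longrightarrow>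
        \<bar>F (tuple_add U \<Phi>) - F U - D \<Phi>\<bar> \<le> \<epsilon> * tuple_norm \<Phi>)"

text \<open>
  $v_{xc}(\rho) = \delta(\rho\,\varepsilon_{xc}(\rho))/\delta\rho$ along the densities \<open>density U\<close>:
  the differential of \<open>density\<close> at \<open>U\<close> in direction \<open>\<Phi>\<close> is $4\sum_i u_i\varphi_i$.
\<close>

definition xc_differentiable_at ::
    "fn set \<Rightarrow> (fn \<Rightarrow> fn) \<Rightarrow> (fn \<Rightarrow> fn) \<Rightarrow> ('n::finite) tup \<Rightarrow> bool" where
  "xc_differentiable_at V eps vxc U \<longleftrightarrow>
     (\<forall>i. \<forall>v\<in>V. integrable lborel (\<lambda>r. vxc (density U) r * U i r * v r)) \<and>
     has_differential_on V (\<lambda>W. xc_energy eps (density W))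
       (\<lambda>\<Phi>. LINT r|lborel. vxc (density U) r * (4 * (\<Sum>i\<in>UNIV. U i r * \<Phi> i r))) U"

text \<open>
  \<open>G\<close> is the gradient of the energy at \<open>U\<close> with respect to \<open>tuple_inner\<close>. The last conjunct is the
  evaluation of the differential of the energy in the coordinate directions.
\<close>

definition is_energy_gradient ::
    "fn set \<Rightarrow> fn \<Rightarrow> (fn \<Rightarrow> fn) \<Rightarrow> (fn \<Rightarrow> fn) \<Rightarrow> ('n::finite) tup \<Rightarrow> 'n tup \<Rightarrow> bool" where
  "is_energy_gradient V Vext eps vxc U G \<longleftrightarrow>
     G \<in> tuples V \<and>
     has_differential_on V (ks_energy Vext eps) (tuple_inner G) U \<and>
     (\<forall>i. \<forall>v\<in>V. L2_inner (G i) v =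
        4 * (1/2 * grad_inner (U i) v
             + L2_inner (\<lambda>r. Vext r * U i r) v
             + L2_inner (\<lambda>r. hartree_potential (density U) r * U i r) v
             + L2_inner (\<lambda>r. vxc (density U) r * U i r) v))"

text \<open>The extended Grassmann gradient, for a given gradient map \<open>gradE\<close>.\<close>

definition grassmann_grad :: "(('n::finite) tup \<Rightarrow> 'n tup) \<Rightarrow> 'n tup \<Rightarrow> 'n tup" where
  "grassmann_grad gradE U =
     (\<lambda>i r. tuple_mult (gradE U) (gram U U) i r - tuple_mult U (gram U (gradE U)) i r)"

definition midpoint_tuple :: "('n::finite) tup \<Rightarrow> 'n tup \<Rightarrow> 'n tup" where
  "midpoint_tuple U W = (\<lambda>i r. (U i r + W i r) / 2)"

end

theory Submission
  imports Defs
begin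

text \<open>
  Write $W$ for the midpoint of $U_n$ and $U_{n+1}$, and put $S = \langle W^\top W\rangle$ and
  $A = \langle W^\top\nabla E(W)\rangle$. Then
  $\langle U_{n+1}^\top U_{n+1}\rangle - \langle U_n^\top U_n\rangle$ is the symmetrization
  $X + X^\top$ of $X = \langle W^\top (U_{n+1} - U_n)\rangle = -\Delta t_n\,(AS - SA)$. Since $A$
  and $S$ are symmetric, the commutator $AS - SA$ is antisymmetric, so the Gram matrix is conserved.
\<close>

section \<open>Square integrable functions\<close>

text \<open>The product is dominated by the sum of the two squares. This makes
  \<open>L2_inner\<close> of square integrable functions a genuine integral, so that it may be split
  over sums.\<close>

lemma square_integrable_mult_integrable:
  assumes "square_integrable u" "square_integrable v"
  shows "integrable lborel (\<lambda>r. u r * v r)"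
proof (rule Bochner_Integration.integrable_bound)
  show "integrable lborel (\<lambda>r. (u r)\<^sup>2 + (v r)\<^sup>2)"
    using assms by (simp add: square_integrable_def)
  show "(\<lambda>r. u r * v r) \<in> borel_measurable lborel"
    using assms by (auto simp: square_integrable_def)
  \<comment> \<open>The square bound controls twice the absolute product; nonnegativity of that
    product lets the factor 2 be dropped.\<close>
  have "\<bar>a * b\<bar> \<le> a\<^sup>2 + b\<^sup>2" for a b :: real
    using sum_squares_bound[of "\<bar>a\<bar>" "\<bar>b\<bar>"] abs_ge_zero[of "a * b"]
    unfolding abs_mult power2_abs by linarith
  then show "AE r in lborel. norm (u r * v r) \<le> norm ((u r)\<^sup>2 + (v r)\<^sup>2)"
    by simp
qed

lemma square_integrable_add:
  assumes "square_integrable u" "square_integrable v"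
  shows "square_integrable (\<lambda>r. u r + v r)"
proof -
  have "integrable lborel (\<lambda>r. (u r)\<^sup>2 + (v r)\<^sup>2 + 2 * (u r * v r))"
    using assms square_integrable_mult_integrable[OF assms]
    by (auto simp: square_integrable_def)
  then show ?thesis
    using assms by (auto simp: square_integrable_def power2_sum mult.assoc)
qed

lemma square_integrable_scale:
  assumes "square_integrable u"
  shows "square_integrable (\<lambda>r. c * u r)"
  using assms by (auto simp: square_integrable_def power_mult_distrib)

lemma square_integrable_sum:
  assumes "finite I" "\<And>i. i \<in> I \<Longrightarrow> square_integrable (u i)"
  shows "square_integrable (\<lambda>r. \<Sum>i\<in>I. u i r)"
  using assms
proof (induction I rule: finite_induct)
  case empty
  then show ?case by (simp add: square_integrable_def)
next
  case (insert i I)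
  then show ?case by (simp add: square_integrable_add)
qed

lemma square_integrable_compact_support:
  assumes "continuous_on UNIV f" "compact K" "\<And>r. r \<notin> K \<Longrightarrow> f r = 0"
  shows "square_integrable f"
proof -
  have "integrable lborel (\<lambda>r. indicator K r *\<^sub>R (f r)\<^sup>2)"
    by (rule borel_integrable_compact[OF assms(2)])
      (intro continuous_intros continuous_on_subset[OF assms(1)] subset_UNIV)
  moreover have "(\<lambda>r. indicator K r *\<^sub>R (f r)\<^sup>2) = (\<lambda>r. (f r)\<^sup>2)"
  proof
    show "indicator K r *\<^sub>R (f r)\<^sup>2 = (f r)\<^sup>2" for r
      using assms(3)[of r] by (cases "r \<in> K") auto
  qed
  ultimately show ?thesis
    using borel_measurable_continuous_onI[OF assms(1)] by (simp add: square_integrable_def)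
qed

section \<open>Symmetry and bilinearity of the L2 inner product\<close>

lemma L2_inner_commute: "L2_inner u v = L2_inner v u"
  by (simp add: L2_inner_def mult.commute)

lemma L2_inner_add_left:
  assumes "square_integrable u" "square_integrable v" "square_integrable w"
  shows "L2_inner (\<lambda>r. u r + v r) w = L2_inner u w + L2_inner v w"
  using assms
  by (simp add: L2_inner_def distrib_right square_integrable_mult_integrable)

lemma L2_inner_scale_left: "L2_inner (\<lambda>r. c * u r) v = c * L2_inner u v"
  by (simp add: L2_inner_def mult.assoc)

lemma L2_inner_diff_right:
  assumes "square_integrable u" "square_integrable v" "square_integrable w"
  shows "L2_inner u (\<lambda>r. v r - w r) = L2_inner u v - L2_inner u w"
  using assms
  by (simp add: L2_inner_def right_diff_distrib square_integrable_mult_integrable)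


section \<open>Linear structure of the discretization space\<close>

lemma zero_outside_closure_support:
  assumes "r \<notin> closure {s. f s \<noteq> 0}"
  shows "f r = 0"
proof (rule ccontr)
  assume "f r \<noteq> 0"
  then have "r \<in> {s. f s \<noteq> 0}" by simp
  then have "r \<in> closure {s. f s \<noteq> 0}" by (rule subsetD[OF closure_subset])
  with assms show False by contradiction
qed

lemma test_function_square_integrable:
  assumes "test_function f"
  shows "square_integrable f"
proof (rule square_integrable_compact_support)
  have "C_k 0 f"
    using assms unfolding test_function_def by blast
  then show "continuous_on UNIV f"
    by simp
  show "compact (closure {r. f r \<noteq> 0})"
    using assms by (simp add: test_function_def)
  show "f r = 0" if "r \<notin> closure {r. f r \<noteq> 0}" for r
    using that by (rule zero_outside_closure_support)
qed

lemma partial_deriv_square_integrable: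
  assumes "test_function f"
  shows "square_integrable (partial_deriv k f)"
proof (rule square_integrable_compact_support)
  \<comment> \<open>One level of \<open>C_k\<close> already contains continuity of every partial
    derivative, since level 0 is plain continuity.\<close>
  have "C_k (Suc 0) f"
    using assms unfolding test_function_def by blast
  then show "continuous_on UNIV (partial_deriv k f)"
    by simp
  show "compact (closure {r. f r \<noteq> 0})"
    using assms by (simp add: test_function_def)
  fix r assume r: "r \<notin> closure {r. f r \<noteq> 0}"
  \<comment> \<open>The complement of the closed support is open, so \<open>f\<close> vanishes on a
    whole neighbourhood of \<open>r\<close>; the support of \<open>f\<close> thus also serves for
    its derivatives.\<close>
  have "(f has_derivative (\<lambda>_. 0)) (at r)"
  proof (rule has_derivative_transform_within_open)
    show "((\<lambda>_. 0) has_derivative (\<lambda>_. 0)) (at r)" by simp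
    show "open (- closure {r. f r \<noteq> 0})" by (rule open_Compl[OF closed_closure])
    show "r \<in> - closure {r. f r \<noteq> 0}" using r by simp
    show "0 = f s" if "s \<in> - closure {r. f r \<noteq> 0}" for s
      using that zero_outside_closure_support[of s f] unfolding Compl_iff by metis
  qed
  then have "frechet_derivative f (at r) = (\<lambda>_. 0)"
    by (rule frechet_derivative_at[symmetric])
  then show "partial_deriv k f r = 0"
    by (simp add: partial_deriv_def)
qed

text \<open>Both sides of the integration by parts formula are additive once each integral exists;
  this is where test functions and their partial derivatives must be square integrable.\<close>

lemma has_weak_gradient_add:
  assumes "square_integrable u" "square_integrable v"
    and "has_weak_gradient u g" "has_weak_gradient v h"
  shows "has_weak_gradient (\<lambda>r. u r + v r) (\<lambda>r. g r + h r)"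
  unfolding has_weak_gradient_def
proof (intro conjI allI impI)
  fix k
  have g: "square_integrable (\<lambda>r. g r $ k)" and h: "square_integrable (\<lambda>r. h r $ k)"
    using assms(3,4) by (simp_all add: has_weak_gradient_def)
  then show "square_integrable (\<lambda>r. (g r + h r) $ k)"
    by (simp add: square_integrable_add)
  fix f assume f: "test_function f"
  have "L2_inner (\<lambda>r. u r + v r) (partial_deriv k f)
      = L2_inner u (partial_deriv k f) + L2_inner v (partial_deriv k f)"
    by (rule L2_inner_add_left[OF assms(1,2) partial_deriv_square_integrable[OF f]])
  also have "\<dots> = - (L2_inner (\<lambda>r. g r $ k) f + L2_inner (\<lambda>r. h r $ k) f)"
    using assms(3,4) f by (simp add: has_weak_gradient_def)
  also have "\<dots> = - L2_inner (\<lambda>r. (g r + h r) $ k) f"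
    using L2_inner_add_left[OF g h test_function_square_integrable[OF f]] by simp
  finally show "L2_inner (\<lambda>r. u r + v r) (partial_deriv k f)
      = - L2_inner (\<lambda>r. (g r + h r) $ k) f" .
qed

lemma has_weak_gradient_scale:
  assumes "has_weak_gradient u g"
  shows "has_weak_gradient (\<lambda>r. c * u r) (\<lambda>r. c *\<^sub>R g r)"
  using assms
  by (auto simp: has_weak_gradient_def square_integrable_scale L2_inner_scale_left)

lemma H1_add: "u \<in> H1 \<Longrightarrow> v \<in> H1 \<Longrightarrow> (\<lambda>r. u r + v r) \<in> H1"
  unfolding H1_def using square_integrable_add has_weak_gradient_add by blast

lemma H1_scale: "u \<in> H1 \<Longrightarrow> (\<lambda>r. c * u r) \<in> H1"
  unfolding H1_def using square_integrable_scale has_weak_gradient_scale by blast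

section \<open>Closure properties of the discretization space\<close>

lemma H1_subspace_of_dim_subset: "H1_subspace_of_dim V d \<Longrightarrow> V \<subseteq> H1"
  by (auto simp: H1_subspace_of_dim_def)

lemma H1_subspace_of_dim_add:
  assumes "H1_subspace_of_dim V d" "u \<in> V" "v \<in> V"
  shows "(\<lambda>r. u r + v r) \<in> V"
proof -
  obtain b where V: "V = {v \<in> H1. \<exists>c :: nat \<Rightarrow> real. AE r in lborel. v r = (\<Sum>k<d. c k * b k r)}"
    using assms(1) unfolding H1_subspace_of_dim_def by blast
  obtain c where c: "AE r in lborel. u r = (\<Sum>k<d. c k * b k r)"
    using assms(2) V by blast
  obtain e where e: "AE r in lborel. v r = (\<Sum>k<d. e k * b k r)"
    using assms(3) V by blast
  have "AE r in lborel. u r + v r = (\<Sum>k<d. (c k + e k) * b k r)"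
    using c e by eventually_elim (simp add: distrib_right sum.distrib)
  then show ?thesis
    using assms(2,3) H1_add unfolding V by (auto intro!: exI[of _ "\<lambda>k. c k + e k"])
qed

lemma H1_subspace_of_dim_scale:
  assumes "H1_subspace_of_dim V d" "u \<in> V"
  shows "(\<lambda>r. a * u r) \<in> V"
proof -
  obtain b where V: "V = {v \<in> H1. \<exists>c :: nat \<Rightarrow> real. AE r in lborel. v r = (\<Sum>k<d. c k * b k r)}"
    using assms(1) unfolding H1_subspace_of_dim_def by blast
  obtain c where c: "AE r in lborel. u r = (\<Sum>k<d. c k * b k r)"
    using assms(2) V by blast
  have "AE r in lborel. a * u r = (\<Sum>k<d. (a * c k) * b k r)"
    using c by eventually_elim (simp add: sum_distrib_left mult.assoc)
  then show ?thesis
    using assms(2) H1_scale unfolding V by (auto intro!: exI[of _ "\<lambda>k. a * c k"])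
qed

text \<open>The energy gradient is specified only at tuples over \<open>V\<close>, so the scheme's
  evaluation point has to be one of them.\<close>

lemma midpoint_tuple_in_tuples:
  assumes "H1_subspace_of_dim V d" "U \<in> tuples V" "W \<in> tuples V"
  shows "midpoint_tuple U W \<in> tuples V"
  unfolding tuples_def
proof (intro CollectI allI)
  fix i
  have "(\<lambda>r. 1/2 * (U i r + W i r)) \<in> V"
    using assms
    by (intro H1_subspace_of_dim_scale[OF assms(1)] H1_subspace_of_dim_add[OF assms(1)])
      (auto simp: tuples_def)
  then show "midpoint_tuple U W i \<in> V"
    by (simp add: midpoint_tuple_def)
qed

lemma tuples_square_integrable:
  assumes "H1_subspace_of_dim V d" "U \<in> tuples V"
  shows "square_integrable (U i)"
  using assms H1_subspace_of_dim_subset by (fastforce simp: tuples_def H1_def)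


section \<open>Gram matrices\<close>

lemma gram_transpose: "transpose (gram \<Psi> \<Phi>) = gram \<Phi> \<Psi>"
  by (simp add: transpose_def gram_def vec_eq_iff L2_inner_commute)

lemma tuple_mult_square_integrable:
  assumes "\<And>i. square_integrable (\<Phi> i)"
  shows "square_integrable (tuple_mult \<Phi> P i)"
  unfolding tuple_mult_def
  by (intro square_integrable_sum square_integrable_scale assms) simp

text \<open>Component \<open>i\<close> of \<open>tuple_mult\<close> takes its coefficients from
  column \<open>i\<close> of the matrix, which is why \<open>P\<close> comes out on the right and
  untransposed.\<close>

lemma gram_tuple_mult_right:
  assumes "\<And>i. square_integrable (\<Psi> i)" "\<And>i. square_integrable (\<Phi> i)"
  shows "gram \<Psi> (tuple_mult \<Phi> P) = gram \<Psi> \<Phi> ** P"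
proof -
  have "L2_inner (\<Psi> i) (tuple_mult \<Phi> P j) = (\<Sum>k\<in>UNIV. L2_inner (\<Psi> i) (\<Phi> k) * P $ k $ j)" for i j
  proof -
    have "L2_inner (\<Psi> i) (tuple_mult \<Phi> P j)
        = (LINT r|lborel. (\<Sum>k\<in>UNIV. (\<Psi> i r * \<Phi> k r) * P $ k $ j))"
      by (simp add: L2_inner_def tuple_mult_def sum_distrib_left ac_simps)
    also have "\<dots> = (\<Sum>k\<in>UNIV. LINT r|lborel. (\<Psi> i r * \<Phi> k r) * P $ k $ j)"
      using assms by (intro Bochner_Integration.integral_sum) (simp add: square_integrable_mult_integrable)
    finally show ?thesis
      by (simp add: L2_inner_def)
  qed
  then show ?thesis
    by (simp add: gram_def matrix_matrix_mult_def vec_eq_iff)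
qed

text \<open>Pairing the extended Grassmann gradient with its own base point turns it into a matrix
  commutator.\<close>

lemma gram_grassmann_grad:
  assumes "\<And>i. square_integrable (W i)" "\<And>i. square_integrable (gradE W i)"
  shows "gram W (grassmann_grad gradE W)
    = gram W (gradE W) ** gram W W - gram W W ** gram W (gradE W)"
proof -
  have "gram W (grassmann_grad gradE W)
      = gram W (tuple_mult (gradE W) (gram W W)) - gram W (tuple_mult W (gram W (gradE W)))"
    using assms
    by (simp add: gram_def grassmann_grad_def vec_eq_iff L2_inner_diff_right
        tuple_mult_square_integrable)
  then show ?thesis
    using assms by (simp add: gram_tuple_mult_right)
qed

text \<open>The Dirichlet form is symmetric, and so is multiplication by a potential. All components
  see the same potentials because these depend on the tuple only through its density.\<close>

lemma gram_energy_gradient_symmetric: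
  assumes "is_energy_gradient V Vext eps vxc W G" "W \<in> tuples V"
  shows "transpose (gram W G) = gram W G"
proof -
  have W: "W i \<in> V" for i
    using assms(2) by (simp add: tuples_def)
  \<comment> \<open>The two integrands coincide pointwise, so the equation holds for every
    \<open>p\<close>, whether or not the integral exists.\<close>
  have pot: "L2_inner (\<lambda>r. p r * W i r) (W j) = L2_inner (\<lambda>r. p r * W j r) (W i)" for p i j
    by (simp add: L2_inner_def ac_simps)
  have kin: "grad_inner (W i) (W j) = grad_inner (W j) (W i)" for i j
    by (simp add: grad_inner_def inner_commute)
  have grad: "L2_inner (G i) v = 4 * (1/2 * grad_inner (W i) v
      + L2_inner (\<lambda>r. Vext r * W i r) v
      + L2_inner (\<lambda>r. hartree_potential (density W) r * W i r) v
      + L2_inner (\<lambda>r. vxc (density W) r * W i r) v)" if "v \<in> V" for i v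
    using assms(1) that unfolding is_energy_gradient_def by blast
  have "L2_inner (G i) (W j) = L2_inner (G j) (W i)" for i j
    by (simp only: grad[OF W] kin[of i j] pot[of _ i j])
  then show ?thesis
    by (simp add: transpose_def gram_def vec_eq_iff L2_inner_commute)
qed

section \<open>Conservation of the Gram matrix over one midpoint step\<close>

lemma transpose_commutator:
  fixes A S :: "real^'n^'n"
  assumes "transpose A = A" "transpose S = S"
  shows "transpose (A ** S - S ** A) = - (A ** S - S ** A)"
proof -
  have "transpose (A ** S - S ** A) = transpose (A ** S) - transpose (S ** A)"
    by (simp add: transpose_def vec_eq_iff)
  then show ?thesis
    by (simp add: matrix_transpose_mul assms)
qed

text \<open>Matrix form of \<open>a\<^sup>2 - b\<^sup>2 = (a + b) * (a - b)\<close>: the mixed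
  products in \<open>X\<close> change sign under transposition and cancel in the sum. The midpoint
  is what makes this exact for a quadratic quantity.\<close>

lemma gram_diff_eq:
  assumes "\<And>i. square_integrable (U i)" "\<And>i. square_integrable (W i)"
  defines "X \<equiv> gram (midpoint_tuple U W) (\<lambda>i r. U i r - W i r)"
  shows "gram U U - gram W W = X + transpose X"
proof -
  have int: "integrable lborel (\<lambda>r. f r * g r)"
    if "f \<in> range U \<union> range W" "g \<in> range U \<union> range W" for f g
    using that assms(1,2) by (auto intro: square_integrable_mult_integrable)
  have eq: "L2_inner (midpoint_tuple U W i) (\<lambda>r. U j r - W j r)
      = (L2_inner (U i) (U j) - L2_inner (U i) (W j)
          + L2_inner (W i) (U j) - L2_inner (W i) (W j)) / 2" for i j
  proof -
    have "L2_inner (midpoint_tuple U W i) (\<lambda>r. U j r - W j r)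
      = (LINT r|lborel. (U i r * U j r - U i r * W j r + W i r * U j r - W i r * W j r) / 2)"
      unfolding L2_inner_def midpoint_tuple_def
      by (intro Bochner_Integration.integral_cong refl) (simp add: field_simps)
    then show ?thesis
      by (simp add: L2_inner_def int)
  qed
  have "L2_inner (U i) (U j) - L2_inner (W i) (W j)
      = L2_inner (midpoint_tuple U W i) (\<lambda>r. U j r - W j r)
        + L2_inner (midpoint_tuple U W j) (\<lambda>r. U i r - W i r)" for i j
    unfolding eq L2_inner_commute[of "U j"] L2_inner_commute[of "W j"] by argo
  then show ?thesis
    by (simp add: X_def vec_eq_iff gram_def transpose_def)
qed

text \<open>Here \<open>U\<close> is the new iterate and \<open>W\<close> the old one. Of the
  energy, only the symmetry of the Gram matrix between the midpoint and the gradient enters.\<close>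

lemma midpoint_step_gram_eq:
  assumes "\<And>i. square_integrable (U i)" "\<And>i. square_integrable (W i)"
    and M: "\<And>i. square_integrable (midpoint_tuple U W i)"
    and G: "\<And>i. square_integrable (gradE (midpoint_tuple U W) i)"
    and sym: "transpose (gram (midpoint_tuple U W) (gradE (midpoint_tuple U W)))
      = gram (midpoint_tuple U W) (gradE (midpoint_tuple U W))"
    and "\<tau> \<noteq> 0"
    and step: "\<And>i. AE r in lborel.
      (U i r - W i r) / \<tau> = - grassmann_grad gradE (midpoint_tuple U W) i r"
  shows "gram U U = gram W W"
proof -
  define M where "M = midpoint_tuple U W"
  define C where "C = gram M (grassmann_grad gradE M)"
  have Gr: "square_integrable (grassmann_grad gradE M i)" for i
    using square_integrable_add[OF tuple_mult_square_integrable
        square_integrable_scale[of _ "-1", OF tuple_mult_square_integrable], of "gradE M" M] M G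
    by (simp add: grassmann_grad_def M_def)
  \<comment> \<open>The scheme holds only almost everywhere, and replacing an integrand on that
    basis with \<open>integral_cong_AE\<close> requires measurability of both sides.\<close>
  have meas [measurable]: "U i \<in> borel_measurable borel" "W i \<in> borel_measurable borel"
    "M i \<in> borel_measurable borel" "grassmann_grad gradE M i \<in> borel_measurable borel" for i
    using assms(1,2) M Gr by (auto simp: M_def square_integrable_def)
  have "L2_inner (M i) (\<lambda>r. U j r - W j r) = - \<tau> * L2_inner (M i) (grassmann_grad gradE M j)" for i j
  proof -
    have "AE r in lborel. M i r * (U j r - W j r) = - \<tau> * (M i r * grassmann_grad gradE M j r)"
      using step[of j] unfolding M_def[symmetric]
    proof eventually_elim
      case (elim r)
      then have "U j r - W j r = - \<tau> * grassmann_grad gradE M j r"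
        using \<open>\<tau> \<noteq> 0\<close> by (simp add: field_simps)
      then show ?case
        by simp
    qed
    then have "L2_inner (M i) (\<lambda>r. U j r - W j r)
        = (LINT r|lborel. - \<tau> * (M i r * grassmann_grad gradE M j r))"
      unfolding L2_inner_def by (intro integral_cong_AE) auto
    then show ?thesis
      by (simp add: L2_inner_def)
  qed
  then have "gram M (\<lambda>i r. U i r - W i r) = - \<tau> *\<^sub>R C"
    by (simp add: C_def gram_def vec_eq_iff)
  moreover have "transpose C = - C"
    unfolding C_def using M G sym
    by (simp add: M_def gram_grassmann_grad transpose_commutator gram_transpose)
  moreover have "transpose (- \<tau> *\<^sub>R C) = - \<tau> *\<^sub>R transpose C"
    by (simp add: transpose_def vec_eq_iff)
  \<comment> \<open>With \<open>X\<close> equal to \<open>- \<tau> *\<^sub>R C\<close> and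
    \<open>C\<close> antisymmetric, \<open>X\<close> and its transpose add up to zero.\<close>
  ultimately have "gram U U - gram W W = 0"
    using gram_diff_eq[of U W] assms(1,2) by (simp only: M_def) simp
  then show ?thesis by simp
qed

section \<open>Orthonormality along the whole iteration\<close>

theorem proposition4p4:
  fixes V :: "fn set" and Ng :: nat
    and Vext :: fn and eps_xc v_xc :: "fn \<Rightarrow> fn"
    and gradE :: "('n::finite) tup \<Rightarrow> 'n tup"
    and dt :: "nat \<Rightarrow> real" and U :: "nat \<Rightarrow> 'n tup"
  assumes V: "H1_subspace_of_dim V Ng"
    and xc: "\<forall>W\<in>(tuples V :: 'n tup set). xc_differentiable_at V eps_xc v_xc W"
    and gradE: "\<forall>W\<in>tuples V. is_energy_gradient V Vext eps_xc v_xc W (gradE W)"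
    and U0: "U 0 \<in> tuples V \<inter> stiefel"
    and dt: "\<forall>n. dt n > 0"
    and U: "\<forall>n. U n \<in> tuples V"
    and scheme: "\<forall>n i. AE r in lborel.
        (U (Suc n) i r - U n i r) / dt n
          = - grassmann_grad gradE (midpoint_tuple (U (Suc n)) (U n)) i r"
  shows "\<forall>n. U n \<in> tuples V \<inter> stiefel"
proof
  fix n
  have sq: "square_integrable (W i)" if "W \<in> tuples V" for W :: "'n tup" and i
    using tuples_square_integrable[OF V that] .
  \<comment> \<open>Only the Gram identity is carried by the induction; the H1 part of
    \<open>stiefel\<close> follows from the inclusion of \<open>V\<close> in
    \<open>H1\<close>.\<close>
  have "gram (U n) (U n) = mat 1"
  proof (induction n)
    case 0
    then show ?case
      using U0 by (simp add: stiefel_def)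
  next
    case (Suc n)
    define M where "M = midpoint_tuple (U (Suc n)) (U n)"
    have M: "M \<in> tuples V"
      unfolding M_def using midpoint_tuple_in_tuples[OF V] U by blast
    have grad: "is_energy_gradient V Vext eps_xc v_xc M (gradE M)"
      using gradE M by blast
    then have G: "gradE M \<in> tuples V"
      by (simp add: is_energy_gradient_def)
    have "gram (U (Suc n)) (U (Suc n)) = gram (U n) (U n)"
    proof (rule midpoint_step_gram_eq[where U = "U (Suc n)" and W = "U n" and gradE = gradE and \<tau> = "dt n",
          folded M_def])
      show "square_integrable (U (Suc n) i)" "square_integrable (U n i)"
        "square_integrable (M i)" "square_integrable (gradE M i)" for i
        using U M G by (blast intro: sq)+
      show "transpose (gram M (gradE M)) = gram M (gradE M)"
        by (rule gram_energy_gradient_symmetric[OF grad M])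
      show "dt n \<noteq> 0"
        using dt by (metis less_irrefl)
      show "AE r in lborel. (U (Suc n) i r - U n i r) / dt n = - grassmann_grad gradE M i r" for i
        using scheme unfolding M_def by blast
    qed
    then show ?case
      using Suc.IH by simp
  qed
  moreover have "U n i \<in> H1" for i
    using U H1_subspace_of_dim_subset[OF V] by (auto simp: tuples_def)
  ultimately show "U n \<in> tuples V \<inter> stiefel"
    using U by (simp add: stiefel_def)
qed

end
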